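(* Let $\lambda\neq0$ be a real number. A smooth vector field on $(H_3,g_2)$ is affine if and only if it is Killing.
   Context: The Heisenberg group $H_3$ is $\mathbb{R}^3$ with global coordinates $(x,y,z)$ and multiplication $(x,y,z)(\tilde x,\tilde y,\tilde z)=(x+\tilde x,y+\tilde y,z+\tilde z-x\tilde y)$. For $\lambda\neq0$, $g_2$ is the left-invariant Lorentzian metric $g_2=\frac{1}{\lambda^2}dx^2+dy^2-(x\,dy+dz)^2$. A smooth vector field $X$ on a pseudo-Riemannian manifold $(M,g)$ with Levi-Civita connection $\nabla$ is Killing if $\mathcal{L}_Xg=0$, and affine if $\mathcal{L}_X\nabla=0$, i.e. $[X,\nabla_YZ]=\nabla_{[X,Y]}Z+\nabla_Y[X,Z]$ for all vector fields $Y,Z$. *)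

theory Defs
  imports "HOL-Analysis.Analysis"
begin

section \<open>Smooth maps\<close>

text \<open>
  The domain is meant to be finite-dimensional: there, continuity of all directional derivatives
  \<open>p \<mapsto> D f(p) v\<close> is continuity of \<open>D f\<close>, so that \<open>Ck k f\<close> says that \<open>f\<close> is of class
  \<open>C\<^sup>k\<close> on the whole space.
\<close>

primrec Ck :: "nat \<Rightarrow> ('a::real_normed_vector \<Rightarrow> 'b::real_normed_vector) \<Rightarrow> bool" where
  "Ck 0 f \<longleftrightarrow> continuous_on UNIV f"
| "Ck (Suc k) f \<longleftrightarrow> (\<forall>p. f differentiable (at p)) \<and>
     (\<forall>v. Ck k (\<lambda>p. frechet_derivative f (at p) v))"

definition smooth :: "('a::real_normed_vector \<Rightarrow> 'b::real_normed_vector) \<Rightarrow> bool" where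
  "smooth f \<longleftrightarrow> (\<forall>k. Ck k f)"

section \<open>Vector fields, metrics and connections on \<open>\<real>\<^sup>3\<close>\<close>

text \<open>
  Every tangent space of \<open>\<real>\<^sup>3\<close> is identified with \<open>\<real>\<^sup>3\<close> through the coordinate frame
  \<open>\<partial>\<^sub>x, \<partial>\<^sub>y, \<partial>\<^sub>z\<close>. A connection acts on vector fields; only its values on smooth fields
  are ever constrained or used.
\<close>

type_synonym point = "real ^ 3"
type_synonym vfield = "point \<Rightarrow> real ^ 3"
type_synonym metric = "point \<Rightarrow> real ^ 3 \<Rightarrow> real ^ 3 \<Rightarrow> real"
type_synonym connection = "vfield \<Rightarrow> vfield \<Rightarrow> vfield"

definition dir_deriv :: "vfield \<Rightarrow> (point \<Rightarrow> 'b::real_normed_vector) \<Rightarrow> point \<Rightarrow> 'b" where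
  "dir_deriv X f = (\<lambda>p. frechet_derivative f (at p) (X p))"

definition lie_bracket :: "vfield \<Rightarrow> vfield \<Rightarrow> vfield" where
  "lie_bracket X Y = (\<lambda>p. dir_deriv X Y p - dir_deriv Y X p)"

definition affine_connection :: "connection \<Rightarrow> bool" where
  "affine_connection nabla \<longleftrightarrow>
     (\<forall>Y Z. smooth Y \<and> smooth Z \<longrightarrow> smooth (nabla Y Z)) \<and>
     (\<forall>Y Y' Z. smooth Y \<and> smooth Y' \<and> smooth Z \<longrightarrow>
        nabla (\<lambda>p. Y p + Y' p) Z = (\<lambda>p. nabla Y Z p + nabla Y' Z p)) \<and>
     (\<forall>(f :: point \<Rightarrow> real) Y Z. smooth f \<and> smooth Y \<and> smooth Z \<longrightarrow>
        nabla (\<lambda>p. f p *\<^sub>R Y p) Z = (\<lambda>p. f p *\<^sub>R nabla Y Z p)) \<and>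
     (\<forall>Y Z Z'. smooth Y \<and> smooth Z \<and> smooth Z' \<longrightarrow>
        nabla Y (\<lambda>p. Z p + Z' p) = (\<lambda>p. nabla Y Z p + nabla Y Z' p)) \<and>
     (\<forall>(f :: point \<Rightarrow> real) Y Z. smooth f \<and> smooth Y \<and> smooth Z \<longrightarrow>
        nabla Y (\<lambda>p. f p *\<^sub>R Z p) = (\<lambda>p. dir_deriv Y f p *\<^sub>R Z p + f p *\<^sub>R nabla Y Z p))"

definition torsion_free :: "connection \<Rightarrow> bool" where
  "torsion_free nabla \<longleftrightarrow>
     (\<forall>Y Z. smooth Y \<and> smooth Z \<longrightarrow>
        (\<lambda>p. nabla Y Z p - nabla Z Y p) = lie_bracket Y Z)"

definition metric_compatible :: "metric \<Rightarrow> connection \<Rightarrow> bool" where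
  "metric_compatible g nabla \<longleftrightarrow>
     (\<forall>Y Z W. smooth Y \<and> smooth Z \<and> smooth W \<longrightarrow>
        dir_deriv Y (\<lambda>p. g p (Z p) (W p)) =
          (\<lambda>p. g p (nabla Y Z p) (W p) + g p (Z p) (nabla Y W p)))"

definition levi_civita :: "metric \<Rightarrow> connection \<Rightarrow> bool" where
  "levi_civita g nabla \<longleftrightarrow>
     affine_connection nabla \<and> torsion_free nabla \<and> metric_compatible g nabla"

section \<open>Killing and affine vector fields\<close>

definition lie_deriv_metric :: "vfield \<Rightarrow> metric \<Rightarrow> vfield \<Rightarrow> vfield \<Rightarrow> point \<Rightarrow> real" where
  "lie_deriv_metric X g Y Z = (\<lambda>p.
     dir_deriv X (\<lambda>q. g q (Y q) (Z q)) p
     - g p (lie_bracket X Y p) (Z p) - g p (Y p) (lie_bracket X Z p))"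

definition killing_field :: "metric \<Rightarrow> vfield \<Rightarrow> bool" where
  "killing_field g X \<longleftrightarrow>
     (\<forall>Y Z. smooth Y \<and> smooth Z \<longrightarrow> lie_deriv_metric X g Y Z = (\<lambda>p. 0))"

definition affine_field :: "connection \<Rightarrow> vfield \<Rightarrow> bool" where
  "affine_field nabla X \<longleftrightarrow>
     (\<forall>Y Z. smooth Y \<and> smooth Z \<longrightarrow>
        lie_bracket X (nabla Y Z) =
          (\<lambda>p. nabla (lie_bracket X Y) Z p + nabla Y (lie_bracket X Z) p))"

section \<open>The Heisenberg group and its metric\<close>

text \<open>The coordinates \<open>x, y, z\<close> of \<open>p\<close> are \<open>p $ 1, p $ 2, p $ 3\<close>.\<close>

definition heis_mult :: "point \<Rightarrow> point \<Rightarrow> point" where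
  "heis_mult p q = vector [p $ 1 + q $ 1, p $ 2 + q $ 2, p $ 3 + q $ 3 - p $ 1 * q $ 2]"

definition g2 :: "real \<Rightarrow> metric" where
  "g2 lam p v w = (1 / lam\<^sup>2) * (v $ 1 * w $ 1) + v $ 2 * w $ 2
     - (p $ 1 * v $ 2 + v $ 3) * (p $ 1 * w $ 2 + w $ 3)"

lemma g2_left_invariant:
  "g2 lam (heis_mult a p) (frechet_derivative (heis_mult a) (at p) v)
     (frechet_derivative (heis_mult a) (at p) w) = g2 lam p v w"
proof -
  define T :: "real^3 \<Rightarrow> real^3" where "T = (\<lambda>q. vector [q $ 1, q $ 2, q $ 3 - a $ 1 * q $ 2])"
  have "linear T"
    by (rule linearI) (simp_all add: T_def vec_eq_iff forall_3 vector_3 algebra_simps)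
  then have "bounded_linear T"
    by (simp add: linear_conv_bounded_linear)
  then have "((\<lambda>q. a + T q) has_derivative T) (at p)"
    by (auto intro!: derivative_eq_intros bounded_linear_imp_has_derivative)
  moreover have "heis_mult a = (\<lambda>q. a + T q)"
    by (simp add: fun_eq_iff heis_mult_def T_def vec_eq_iff forall_3 vector_3)
  ultimately have "frechet_derivative (heis_mult a) (at p) = T"
    using frechet_derivative_at by metis
  then show ?thesis
    by (simp add: g2_def heis_mult_def T_def vector_3 algebra_simps)
qed

section \<open>The Levi-Civita connection of \<open>g2\<close> exists\<close>

lemma Ck_Suc_imp: "Ck (Suc k) f \<Longrightarrow> Ck k f"
proof (induction k arbitrary: f)
  case 0
  then show ?case
    by (auto intro!: continuous_at_imp_continuous_on differentiable_imp_continuous_within)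
next
  case (Suc k)
  have "f differentiable (at p)" for p using Suc.prems by simp
  moreover have "Ck k (\<lambda>p. frechet_derivative f (at p) v)" for v
  proof (rule Suc.IH)
    show "Ck (Suc k) (\<lambda>p. frechet_derivative f (at p) v)"
      using Suc.prems unfolding Ck.simps(2)[of "Suc k"] by blast
  qed
  ultimately show ?case by simp
qed

lemma Ck_const: "Ck k (\<lambda>p. c)"
  by (induction k arbitrary: c) auto

lemma Ck_bounded_linear:
  assumes "bounded_linear L" shows "Ck k f \<Longrightarrow> Ck k (\<lambda>p. L (f p))"
proof (induction k arbitrary: f)
  case 0
  then show ?case using assms by (simp add: bounded_linear.continuous_on)
next
  case (Suc k)
  have d: "((\<lambda>q. L (f q)) has_derivative (\<lambda>v. L (frechet_derivative f (at p) v))) (at p)" for p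
    using Suc.prems by (intro bounded_linear.has_derivative[OF assms])
      (simp add: frechet_derivative_works)
  then have "frechet_derivative (\<lambda>q. L (f q)) (at p) = (\<lambda>v. L (frechet_derivative f (at p) v))" for p
    by (metis frechet_derivative_at)
  then show ?case using d Suc by (auto simp: differentiable_def)
qed

lemma Ck_add: "Ck k f \<Longrightarrow> Ck k g \<Longrightarrow> Ck k (\<lambda>p. f p + g p)"
proof (induction k arbitrary: f g)
  case 0
  then show ?case by (simp add: continuous_on_add)
next
  case (Suc k)
  have d: "((\<lambda>q. f q + g q) has_derivative
      (\<lambda>v. frechet_derivative f (at p) v + frechet_derivative g (at p) v)) (at p)" for p
    using Suc.prems by (intro has_derivative_add) (simp_all add: frechet_derivative_works)
  then have "frechet_derivative (\<lambda>q. f q + g q) (at p) =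
      (\<lambda>v. frechet_derivative f (at p) v + frechet_derivative g (at p) v)" for p
    by (metis frechet_derivative_at)
  then show ?case using d Suc by (auto simp: differentiable_def)
qed

lemma Ck_bounded_bilinear:
  assumes "bounded_bilinear B" shows "Ck k f \<Longrightarrow> Ck k g \<Longrightarrow> Ck k (\<lambda>p. B (f p) (g p))"
proof (induction k arbitrary: f g)
  case 0
  then show ?case using assms by (simp add: bounded_bilinear.continuous_on)
next
  case (Suc k)
  have d: "((\<lambda>q. B (f q) (g q)) has_derivative
      (\<lambda>v. B (f p) (frechet_derivative g (at p) v) + B (frechet_derivative f (at p) v) (g p)))
      (at p)" for p
    using Suc.prems by (intro bounded_bilinear.FDERIV[OF assms])
      (simp_all add: frechet_derivative_works)
  then have "frechet_derivative (\<lambda>q. B (f q) (g q)) (at p) =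
      (\<lambda>v. B (f p) (frechet_derivative g (at p) v) + B (frechet_derivative f (at p) v) (g p))" for p
    by (metis frechet_derivative_at)
  moreover have "Ck k f" "Ck k g" using Suc.prems Ck_Suc_imp by blast+
  ultimately show ?case using d Suc by (auto simp: differentiable_def intro!: Ck_add)
qed

lemma smooth_const: "smooth (\<lambda>p. c)"
  by (simp add: smooth_def Ck_const)

lemma smooth_add: "smooth f \<Longrightarrow> smooth g \<Longrightarrow> smooth (\<lambda>p. f p + g p)"
  by (simp add: smooth_def Ck_add)

lemma smooth_bounded_linear: "bounded_linear L \<Longrightarrow> smooth f \<Longrightarrow> smooth (\<lambda>p. L (f p))"
  by (simp add: smooth_def Ck_bounded_linear)

lemma smooth_mult:
  fixes f g :: "_ \<Rightarrow> real" shows "smooth f \<Longrightarrow> smooth g \<Longrightarrow> smooth (\<lambda>p. f p * g p)"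
  by (simp add: smooth_def Ck_bounded_bilinear[OF bounded_bilinear_mult])

lemma smooth_scaleR: "smooth f \<Longrightarrow> smooth g \<Longrightarrow> smooth (\<lambda>p. f p *\<^sub>R g p)"
  by (simp add: smooth_def Ck_bounded_bilinear[OF bounded_bilinear_scaleR])

lemma smooth_nth: "smooth f \<Longrightarrow> smooth (\<lambda>p. f p $ i)"
  by (rule smooth_bounded_linear[OF bounded_linear_vec_nth])

lemma smooth_ident: "smooth (\<lambda>p :: 'a::real_normed_vector. p)"
proof -
  have "Ck k (\<lambda>p :: 'a. p)" for k by (cases k) (auto simp: Ck_const)
  then show ?thesis by (simp add: smooth_def)
qed

lemma smooth_differentiable: "smooth f \<Longrightarrow> f differentiable (at p)"
  unfolding smooth_def by (metis Ck.simps(2))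

lemma smooth_frechet: "smooth f \<Longrightarrow> smooth (\<lambda>p. frechet_derivative f (at p) v)"
  unfolding smooth_def by (metis Ck.simps(2))

lemma vec3_expand: "(v :: real^3) = v $ 1 *\<^sub>R axis 1 1 + v $ 2 *\<^sub>R axis 2 1 + v $ 3 *\<^sub>R axis 3 1"
  by (simp add: vec_eq_iff forall_3 axis_def)

lemma smooth_vector3:
  fixes a b c :: "point \<Rightarrow> real"
  assumes "smooth a" "smooth b" "smooth c"
  shows "smooth (\<lambda>p. vector [a p, b p, c p] :: real^3)"
proof -
  have "(\<lambda>p. vector [a p, b p, c p] :: real^3) =
      (\<lambda>p. a p *\<^sub>R axis 1 1 + b p *\<^sub>R axis 2 1 + c p *\<^sub>R axis 3 1)"
    by (simp add: fun_eq_iff vec_eq_iff forall_3 axis_def vector_3)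
  then show ?thesis
    using assms by (simp add: smooth_add smooth_scaleR smooth_const)
qed

lemma smooth_dir_deriv:
  assumes "smooth X" "smooth f" shows "smooth (dir_deriv X f)"
proof -
  let ?d = "\<lambda>p. frechet_derivative f (at p)"
  have "?d p (X p) = X p $ 1 *\<^sub>R ?d p (axis 1 1) + X p $ 2 *\<^sub>R ?d p (axis 2 1)
      + X p $ 3 *\<^sub>R ?d p (axis 3 1)" for p
  proof -
    have lin: "linear (?d p)"
      using smooth_differentiable[OF assms(2)] by (rule linear_frechet_derivative)
    have "?d p (X p) =
        ?d p (X p $ 1 *\<^sub>R axis 1 1 + X p $ 2 *\<^sub>R axis 2 1 + X p $ 3 *\<^sub>R axis 3 1)"
      by (subst vec3_expand[of "X p"]) (rule refl)
    also have "\<dots> = X p $ 1 *\<^sub>R ?d p (axis 1 1) + X p $ 2 *\<^sub>R ?d p (axis 2 1)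
        + X p $ 3 *\<^sub>R ?d p (axis 3 1)"
      by (simp only: linear_add[OF lin] linear_scale[OF lin])
    finally show ?thesis .
  qed
  then show ?thesis
    unfolding dir_deriv_def
    using assms by (simp add: smooth_add smooth_scaleR smooth_nth smooth_frechet)
qed

lemma dir_deriv_has_derivative:
  "smooth f \<Longrightarrow> (f has_derivative frechet_derivative f (at p)) (at p)"
  using smooth_differentiable frechet_derivative_works by blast

lemma dir_deriv_eqI: "(f has_derivative f') (at p) \<Longrightarrow> dir_deriv X f p = f' (X p)"
  unfolding dir_deriv_def by (metis frechet_derivative_at)

text \<open>\<open>christoffel2 lam p v w\<close> is the vector \<open>\<Gamma>\<^sup>k\<^sub>i\<^sub>j(p) v\<^sup>i w\<^sup>j\<close> of \<open>g2 lam\<close>.\<close>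

definition christoffel2 :: "real \<Rightarrow> point \<Rightarrow> real^3 \<Rightarrow> real^3 \<Rightarrow> real^3" where
  "christoffel2 lam p v w = vector [
     lam\<^sup>2 * p $ 1 * (v $ 2 * w $ 2) + lam\<^sup>2 / 2 * (v $ 2 * w $ 3 + v $ 3 * w $ 2),
     - (p $ 1 / 2) * (v $ 1 * w $ 2 + v $ 2 * w $ 1) - 1 / 2 * (v $ 1 * w $ 3 + v $ 3 * w $ 1),
     ((p $ 1)\<^sup>2 + 1) / 2 * (v $ 1 * w $ 2 + v $ 2 * w $ 1)
       + p $ 1 / 2 * (v $ 1 * w $ 3 + v $ 3 * w $ 1)]"

definition nabla2 :: "real \<Rightarrow> connection" where
  "nabla2 lam Y Z = (\<lambda>p. dir_deriv Y Z p + christoffel2 lam p (Y p) (Z p))"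

lemma smooth_minus: "smooth f \<Longrightarrow> smooth (\<lambda>p. - f p)"
  by (rule smooth_bounded_linear[OF bounded_linear_minus[OF bounded_linear_ident]])

lemma smooth_diff: "smooth f \<Longrightarrow> smooth g \<Longrightarrow> smooth (\<lambda>p. f p - g p)"
  using smooth_add[OF _ smooth_minus, of f g] by simp

lemma smooth_christoffel2:
  assumes "smooth Y" "smooth Z"
  shows "smooth (\<lambda>p. christoffel2 lam p (Y p) (Z p))"
proof -
  have half: "p $ 1 / 2 = (1 / 2) * p $ 1"
    and sq: "((p $ 1)\<^sup>2 + 1) / 2 = (1 / 2) * (p $ 1 * p $ 1 + 1)" for p :: point
    by (simp_all add: power2_eq_square)
  show ?thesis
    unfolding christoffel2_def half sq
    by (intro smooth_vector3 smooth_minus smooth_diff smooth_add smooth_mult smooth_const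
        smooth_nth[OF assms(1)] smooth_nth[OF assms(2)] smooth_nth[OF smooth_ident])
qed

theorem levi_civita_nabla2:
  assumes "lam \<noteq> 0" shows "levi_civita (g2 lam) (nabla2 lam)"
  unfolding levi_civita_def
proof (intro conjI)
  note dd = dir_deriv_has_derivative
  have add_left: "dir_deriv (\<lambda>p. Y p + Y' p) Z p = dir_deriv Y Z p + dir_deriv Y' Z p"
    if "smooth Z" for Y Y' :: vfield and Z :: vfield and p
    unfolding dir_deriv_def
    by (rule linear_add[OF linear_frechet_derivative[OF smooth_differentiable[OF that]]])
  have scale_left: "dir_deriv (\<lambda>p. f p *\<^sub>R Y p) Z p = f p *\<^sub>R dir_deriv Y Z p"
    if "smooth Z" for f :: "point \<Rightarrow> real" and Y :: vfield and Z :: vfield and p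
    unfolding dir_deriv_def
    by (rule linear_scale[OF linear_frechet_derivative[OF smooth_differentiable[OF that]]])
  have add_right: "dir_deriv Y (\<lambda>p. Z p + Z' p) p = dir_deriv Y Z p + dir_deriv Y Z' p"
    if "smooth Z" "smooth Z'" for Y :: vfield and Z Z' :: vfield and p
    using dir_deriv_eqI[OF has_derivative_add[OF dd[OF that(1)] dd[OF that(2)]]]
    by (simp add: dir_deriv_def)
  have scale_right: "dir_deriv Y (\<lambda>p. f p *\<^sub>R Z p) p = dir_deriv Y f p *\<^sub>R Z p + f p *\<^sub>R dir_deriv Y Z p"
    if "smooth f" "smooth Z" for f :: "point \<Rightarrow> real" and Y :: vfield and Z :: vfield and p
    using dir_deriv_eqI[OF has_derivative_scaleR[OF dd[OF that(1)] dd[OF that(2)]]]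
    by (simp add: dir_deriv_def add.commute)
  have chr_add1: "christoffel2 lam p (v + v') w = christoffel2 lam p v w + christoffel2 lam p v' w"
    and chr_add2: "christoffel2 lam p w (v + v') = christoffel2 lam p w v + christoffel2 lam p w v'"
    and chr_sc1: "christoffel2 lam p (c *\<^sub>R v) w = c *\<^sub>R christoffel2 lam p v w"
    and chr_sc2: "christoffel2 lam p w (c *\<^sub>R v) = c *\<^sub>R christoffel2 lam p w v"
    and chr_sym: "christoffel2 lam p v w = christoffel2 lam p w v" for p v v' w c
    by (simp_all add: christoffel2_def vec_eq_iff forall_3 vector_3 field_simps)
  show "affine_connection (nabla2 lam)"
    unfolding affine_connection_def
    by (auto simp: nabla2_def fun_eq_iff smooth_add smooth_dir_deriv smooth_christoffel2
        add_left add_right scale_left scale_right chr_add1 chr_add2 chr_sc1 chr_sc2 scaleR_add_right)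
  show "torsion_free (nabla2 lam)"
    unfolding torsion_free_def
    by (auto simp: nabla2_def lie_bracket_def fun_eq_iff chr_sym)
  show "metric_compatible (g2 lam) (nabla2 lam)"
    unfolding metric_compatible_def
  proof (intro allI impI ext)
    fix Y Z W :: vfield and p
    assume s: "smooth Y \<and> smooth Z \<and> smooth W"
    let ?DZ = "frechet_derivative Z (at p)" and ?DW = "frechet_derivative W (at p)"
    have Z: "((\<lambda>q. Z q $ i) has_derivative (\<lambda>v. ?DZ v $ i)) (at p)" for i
      using s by (intro bounded_linear.has_derivative[OF bounded_linear_vec_nth] dd) simp
    have W: "((\<lambda>q. W q $ i) has_derivative (\<lambda>v. ?DW v $ i)) (at p)" for i
      using s by (intro bounded_linear.has_derivative[OF bounded_linear_vec_nth] dd) simp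
    have P: "((\<lambda>q. q $ 1) has_derivative (\<lambda>v. v $ 1)) (at p)"
      by (rule bounded_linear_imp_has_derivative[OF bounded_linear_vec_nth])
    let ?z = "Z p" and ?w = "W p" and ?x = "p $ 1"
    have D: "((\<lambda>q. g2 lam q (Z q) (W q)) has_derivative (\<lambda>v.
        (1 / lam\<^sup>2) * (?z $ 1 * ?DW v $ 1 + ?DZ v $ 1 * ?w $ 1)
        + (?z $ 2 * ?DW v $ 2 + ?DZ v $ 2 * ?w $ 2)
        - ((?x * ?z $ 2 + ?z $ 3) * ((?x * ?DW v $ 2 + v $ 1 * ?w $ 2) + ?DW v $ 3)
          + ((?x * ?DZ v $ 2 + v $ 1 * ?z $ 2) + ?DZ v $ 3) * (?x * ?w $ 2 + ?w $ 3)))) (at p)"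
      unfolding g2_def
      by (intro has_derivative_diff has_derivative_add has_derivative_mult has_derivative_mult_right
          Z W P)
    show "dir_deriv Y (\<lambda>q. g2 lam q (Z q) (W q)) p =
        g2 lam p (nabla2 lam Y Z p) (W p) + g2 lam p (Z p) (nabla2 lam Y W p)"
      using assms unfolding dir_deriv_eqI[OF D]
      by (simp add: dir_deriv_def nabla2_def g2_def christoffel2_def vector_3
          field_simps power2_eq_square)
  qed
qed

end

theory Submission
  imports Defs
begin

text \<open>
  If \<open>X\<close> is Killing, then \<open>L\<^sub>X \<nabla>\<close> is a tensor that is symmetric in its two arguments and skew with
  respect to the metric, hence it vanishes, exactly as in the uniqueness proof of the Levi-Civita
  connection. Conversely, if \<open>X\<close> is affine, then \<open>L\<^sub>X R = 0\<close> for the curvature tensor \<open>R\<close>. In a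
  left-invariant frame the components of \<open>R\<close> are constant, so at each point \<open>L\<^sub>X\<close> acts on the frame
  by an endomorphism that annihilates \<open>R\<close>. Every such endomorphism is skew with respect to the metric
  (a multiple of the identity is excluded because it rescales \<open>R\<close>), which says that \<open>L\<^sub>X g = 0\<close>.
\<close>

section \<open>Symmetry of second derivatives and the Jacobi identity\<close>

lemma DERIV_along_line:
  fixes f :: "'a::real_normed_vector \<Rightarrow> real"
  assumes "f differentiable (at (p + s *\<^sub>R v))"
  shows "((\<lambda>s. f (p + s *\<^sub>R v)) has_real_derivative
    frechet_derivative f (at (p + s *\<^sub>R v)) v) (at s)"
proof -
  let ?D = "frechet_derivative f (at (p + s *\<^sub>R v))"
  have D: "(f has_derivative ?D) (at (p + s *\<^sub>R v))"
    using assms frechet_derivative_works by blast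
  have "((\<lambda>s. p + s *\<^sub>R v) has_derivative (\<lambda>h. h *\<^sub>R v)) (at s)"
    by (auto intro!: derivative_eq_intros)
  from has_derivative_compose[OF this D]
  show ?thesis
    by (rule has_derivative_imp_has_field_derivative)
      (simp add: linear_cmul[OF has_derivative_linear[OF D]])
qed

text \<open>Two applications of the mean value theorem: first along \<open>v\<close> to the
  increment of \<open>f\<close> by \<open>h *\<^sub>R w\<close>, then along \<open>w\<close> to the
  resulting derivative in direction \<open>v\<close>.\<close>

lemma second_difference_mean_value:
  fixes f :: "'a::real_normed_vector \<Rightarrow> real"
  assumes f: "smooth f" and h: "h > 0"
  shows "\<exists>s t. 0 < s \<and> s < h \<and> 0 < t \<and> t < h \<and>
    f (p + h *\<^sub>R v + h *\<^sub>R w) - f (p + h *\<^sub>R v) - f (p + h *\<^sub>R w) + f p =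
    h * (h * frechet_derivative (\<lambda>q. frechet_derivative f (at q) v) (at (p + s *\<^sub>R v + t *\<^sub>R w)) w)"
proof -
  let ?fv = "\<lambda>q. frechet_derivative f (at q) v"
  let ?g = "\<lambda>s. f ((p + h *\<^sub>R w) + s *\<^sub>R v) - f (p + s *\<^sub>R v)"
  have "(?g has_real_derivative ?fv ((p + h *\<^sub>R w) + s *\<^sub>R v) - ?fv (p + s *\<^sub>R v)) (at s)" for s
    by (intro DERIV_diff DERIV_along_line smooth_differentiable f)
  from MVT2[OF h, of ?g, OF this] obtain s where s: "0 < s" "s < h"
    "?g h - ?g 0 = h * (?fv ((p + h *\<^sub>R w) + s *\<^sub>R v) - ?fv (p + s *\<^sub>R v))" by auto
  let ?k = "\<lambda>t. ?fv ((p + s *\<^sub>R v) + t *\<^sub>R w)"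
  have "(?k has_real_derivative frechet_derivative ?fv (at ((p + s *\<^sub>R v) + t *\<^sub>R w)) w) (at t)" for t
    by (rule DERIV_along_line[OF smooth_differentiable[OF smooth_frechet[OF f]]])
  from MVT2[OF h, of ?k, OF this] obtain t where t: "0 < t" "t < h"
    "?k h - ?k 0 = h * frechet_derivative ?fv (at ((p + s *\<^sub>R v) + t *\<^sub>R w)) w" by auto
  have "f (p + h *\<^sub>R v + h *\<^sub>R w) - f (p + h *\<^sub>R v) - f (p + h *\<^sub>R w) + f p = ?g h - ?g 0"
    by (simp add: algebra_simps)
  also have "\<dots> = h * (?k h - ?k 0)" using s(3) by (simp add: algebra_simps)
  finally show ?thesis using s t by metis
qed

text \<open>The second difference is symmetric in \<open>v\<close> and \<open>w\<close>. Divided by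
  the square of \<open>h\<close>, it tends to either mixed derivative as \<open>h\<close> tends to
  0, by continuity.\<close>

lemma second_derivative_symmetric_real:
  fixes f :: "'a::real_normed_vector \<Rightarrow> real"
  assumes f: "smooth f"
  shows "frechet_derivative (\<lambda>q. frechet_derivative f (at q) v) (at p) w =
    frechet_derivative (\<lambda>q. frechet_derivative f (at q) w) (at p) v"
proof -
  define F where "F v w q = frechet_derivative (\<lambda>q. frechet_derivative f (at q) v) (at q) w" for v w q
  have cont: "isCont (F v w) q" for v w q
    unfolding F_def
    by (rule differentiable_imp_continuous_within[OF
          smooth_differentiable[OF smooth_frechet[OF smooth_frechet[OF f]]]])
  have pts: "\<exists>q. dist q p \<le> h * (norm v + norm w) \<and>
      f (p + h *\<^sub>R v + h *\<^sub>R w) - f (p + h *\<^sub>R v) - f (p + h *\<^sub>R w) + f p = h * (h * F v w q)"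
    if h: "h > 0" for h v w
  proof -
    from second_difference_mean_value[OF f h, of p v w] obtain s t where st:
      "0 < s" "s < h" "0 < t" "t < h"
      "f (p + h *\<^sub>R v + h *\<^sub>R w) - f (p + h *\<^sub>R v) - f (p + h *\<^sub>R w) + f p
        = h * (h * F v w (p + s *\<^sub>R v + t *\<^sub>R w))"
      unfolding F_def by blast
    have "dist (p + s *\<^sub>R v + t *\<^sub>R w) p = norm (s *\<^sub>R v + t *\<^sub>R w)"
      by (simp add: dist_norm algebra_simps)
    also have "\<dots> \<le> s * norm v + t * norm w"
      using norm_triangle_ineq[of "s *\<^sub>R v" "t *\<^sub>R w"] st by simp
    also have "\<dots> \<le> h * norm v + h * norm w"
      using st by (intro add_mono mult_right_mono) auto
    finally show ?thesis using st(5) by (metis distrib_left)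
  qed
  \<comment> \<open>\<open>S n\<close> is the mixed derivative at the intermediate point for
    \<open>h = 1 / Suc n\<close>; these points converge to \<open>p\<close>.\<close>
  have lim: "\<exists>S. (S \<longlonglongrightarrow> F v w p) \<and> (\<forall>n. f (p + (1 / Suc n) *\<^sub>R v + (1 / Suc n) *\<^sub>R w)
      - f (p + (1 / Suc n) *\<^sub>R v) - f (p + (1 / Suc n) *\<^sub>R w) + f p = 1 / Suc n * (1 / Suc n * S n))"
    for v w
  proof -
    have "\<forall>n. \<exists>q. dist q p \<le> 1 / Suc n * (norm v + norm w) \<and>
      f (p + (1 / Suc n) *\<^sub>R v + (1 / Suc n) *\<^sub>R w) - f (p + (1 / Suc n) *\<^sub>R v)
       - f (p + (1 / Suc n) *\<^sub>R w) + f p = 1 / Suc n * (1 / Suc n * F v w q)"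
      by (intro allI pts) simp
    then obtain Q where Q: "\<And>n. dist (Q n) p \<le> 1 / Suc n * (norm v + norm w)"
      "\<And>n. f (p + (1 / Suc n) *\<^sub>R v + (1 / Suc n) *\<^sub>R w) - f (p + (1 / Suc n) *\<^sub>R v)
       - f (p + (1 / Suc n) *\<^sub>R w) + f p = 1 / Suc n * (1 / Suc n * F v w (Q n))"
      by metis
    have "(\<lambda>n. 1 / real (Suc n) * (norm v + norm w)) \<longlonglongrightarrow> 0"
      using tendsto_mult_left_zero[OF LIMSEQ_inverse_real_of_nat] by (simp add: inverse_eq_divide)
    then have "(\<lambda>n. dist (Q n) p) \<longlonglongrightarrow> 0"
      by (rule tendsto_sandwich[OF always_eventually always_eventually tendsto_const, rotated 2])
        (use Q(1) in auto)
    then have "Q \<longlonglongrightarrow> p" using tendsto_dist_iff by blast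
    then have "(\<lambda>n. F v w (Q n)) \<longlonglongrightarrow> F v w p"
      by (rule isCont_tendsto_compose[OF cont])
    with Q(2) show ?thesis by blast
  qed
  obtain S where S: "S \<longlonglongrightarrow> F v w p" "\<And>n. f (p + (1 / Suc n) *\<^sub>R v + (1 / Suc n) *\<^sub>R w)
      - f (p + (1 / Suc n) *\<^sub>R v) - f (p + (1 / Suc n) *\<^sub>R w) + f p = 1 / Suc n * (1 / Suc n * S n)"
    using lim[of v w] by blast
  obtain T where T: "T \<longlonglongrightarrow> F w v p" "\<And>n. f (p + (1 / Suc n) *\<^sub>R w + (1 / Suc n) *\<^sub>R v)
      - f (p + (1 / Suc n) *\<^sub>R w) - f (p + (1 / Suc n) *\<^sub>R v) + f p = 1 / Suc n * (1 / Suc n * T n)"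
    using lim[of w v] by blast
  have "S n = T n" for n
  proof -
    have "1 / real (Suc n) * (1 / Suc n * S n) = 1 / Suc n * (1 / Suc n * T n)"
      unfolding S(2)[symmetric] T(2)[symmetric] by (simp add: add.assoc add.commute[of "_ *\<^sub>R v"])
    then show ?thesis by simp
  qed
  then have "S = T" by blast
  with S(1) T(1) show ?thesis unfolding F_def using LIMSEQ_unique by blast
qed

lemma frechet_derivative_bounded_linear:
  assumes "bounded_linear L" "smooth f"
  shows "frechet_derivative (\<lambda>q. L (f q)) (at p) v = L (frechet_derivative f (at p) v)"
  using frechet_derivative_at[OF
      bounded_linear.has_derivative[OF assms(1) dir_deriv_has_derivative[OF assms(2)]], of p]
  by (metis (no_types))

lemma second_derivative_symmetric:
  fixes f :: "'a::real_normed_vector \<Rightarrow> 'b::euclidean_space"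
  assumes f: "smooth f"
  shows "frechet_derivative (\<lambda>q. frechet_derivative f (at q) v) (at p) w =
    frechet_derivative (\<lambda>q. frechet_derivative f (at q) w) (at p) v"
proof (rule euclidean_eqI)
  fix b :: 'b
  note L = bounded_linear_inner_left[of b]
  have "frechet_derivative (\<lambda>q. frechet_derivative f (at q) v) (at p) w \<bullet> b
      = frechet_derivative (\<lambda>q. frechet_derivative (\<lambda>q. f q \<bullet> b) (at q) v) (at p) w" for v w
    by (simp add: frechet_derivative_bounded_linear[OF L] smooth_frechet f)
  then show "frechet_derivative (\<lambda>q. frechet_derivative f (at q) v) (at p) w \<bullet> b =
      frechet_derivative (\<lambda>q. frechet_derivative f (at q) w) (at p) v \<bullet> b"
    using second_derivative_symmetric_real[OF smooth_bounded_linear[OF L f]] by metis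
qed

text \<open>Product rule for \<open>q \<mapsto> D f(q) (Y q)\<close>. Smoothness concerns
  \<open>D f(q) v\<close> for fixed \<open>v\<close> only, so \<open>Y q\<close> is first expanded
  in the standard basis.\<close>

lemma dir_deriv_dir_deriv:
  fixes f :: "point \<Rightarrow> 'b::real_normed_vector"
  assumes "smooth Y" and f: "smooth f"
  shows "dir_deriv X (dir_deriv Y f) p = frechet_derivative f (at p) (dir_deriv X Y p)
    + frechet_derivative (\<lambda>q. frechet_derivative f (at q) (Y p)) (at p) (X p)"
proof -
  let ?d = "\<lambda>q. frechet_derivative f (at q)"
  let ?e = "\<lambda>i. axis i 1 :: real^3"
  have lin: "linear (?d q)" for q
    using smooth_differentiable[OF f] by (rule linear_frechet_derivative)
  have expand: "?d q v = v $ 1 *\<^sub>R ?d q (?e 1) + v $ 2 *\<^sub>R ?d q (?e 2) + v $ 3 *\<^sub>R ?d q (?e 3)" for q v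
    by (subst vec3_expand[of v]) (simp only: linear_add[OF lin] linear_scale[OF lin])
  have E: "((\<lambda>q. ?d q v) has_derivative frechet_derivative (\<lambda>q. ?d q v) (at p)) (at p)" for v
    by (rule dir_deriv_has_derivative[OF smooth_frechet[OF f]])
  have Y: "((\<lambda>q. Y q $ i) has_derivative (\<lambda>u. frechet_derivative Y (at p) u $ i)) (at p)" for i
    by (intro bounded_linear.has_derivative[OF bounded_linear_vec_nth] dir_deriv_has_derivative assms)
  have 1: "((\<lambda>q. ?d q v) has_derivative (\<lambda>u. v $ 1 *\<^sub>R frechet_derivative (\<lambda>q. ?d q (?e 1)) (at p) u
      + v $ 2 *\<^sub>R frechet_derivative (\<lambda>q. ?d q (?e 2)) (at p) u
      + v $ 3 *\<^sub>R frechet_derivative (\<lambda>q. ?d q (?e 3)) (at p) u)) (at p)" for v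
    unfolding expand[of _ v]
    by (intro has_derivative_add has_derivative_scaleR_right E)
  have 2: "dir_deriv Y f = (\<lambda>q. Y q $ 1 *\<^sub>R ?d q (?e 1) + Y q $ 2 *\<^sub>R ?d q (?e 2) + Y q $ 3 *\<^sub>R ?d q (?e 3))"
    unfolding dir_deriv_def fun_eq_iff using expand by blast
  note 3 = has_derivative_add[OF has_derivative_add[OF
        has_derivative_scaleR[OF Y[of 1] E[of "?e 1"]] has_derivative_scaleR[OF Y[of 2] E[of "?e 2"]]]
        has_derivative_scaleR[OF Y[of 3] E[of "?e 3"]]]
  show ?thesis
    unfolding 2 dir_deriv_eqI[OF 3] expand[of p "dir_deriv X Y p"]
      frechet_derivative_at[OF 1[of "Y p"], symmetric]
    by (simp add: dir_deriv_def)
qed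

lemma frechet_derivative_diff:
  assumes "smooth f"
  shows "frechet_derivative f (at p) (v - w) = frechet_derivative f (at p) v - frechet_derivative f (at p) w"
  by (rule linear_diff[OF linear_frechet_derivative[OF smooth_differentiable[OF assms]]])

text \<open>In the commutator the second derivatives of \<open>f\<close> cancel by symmetry, and
  only derivatives of \<open>X\<close> and \<open>Y\<close> remain.\<close>

lemma dir_deriv_lie_bracket:
  fixes f :: "point \<Rightarrow> 'b::euclidean_space"
  assumes "smooth X" "smooth Y" "smooth f"
  shows "dir_deriv (lie_bracket X Y) f p = dir_deriv X (dir_deriv Y f) p - dir_deriv Y (dir_deriv X f) p"
  using assms second_derivative_symmetric[OF assms(3), where p=p and v="X p" and w = "Y p"]
  by (simp add: dir_deriv_dir_deriv)
    (simp add: dir_deriv_def lie_bracket_def frechet_derivative_diff)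

lemma smooth_lie_bracket: "smooth X \<Longrightarrow> smooth Y \<Longrightarrow> smooth (lie_bracket X Y)"
  unfolding lie_bracket_def by (intro smooth_diff smooth_dir_deriv)

lemma dir_deriv_add_right:
  assumes "smooth f" "smooth g"
  shows "dir_deriv X (\<lambda>q. f q + g q) p = dir_deriv X f p + dir_deriv X g p"
  using dir_deriv_eqI[OF has_derivative_add[OF assms[THEN dir_deriv_has_derivative]]]
  by (simp add: dir_deriv_def)

lemma dir_deriv_diff_right:
  assumes "smooth f" "smooth g"
  shows "dir_deriv X (\<lambda>q. f q - g q) p = dir_deriv X f p - dir_deriv X g p"
  using dir_deriv_eqI[OF has_derivative_diff[OF assms[THEN dir_deriv_has_derivative]]]
  by (simp add: dir_deriv_def)

text \<open>Fields are differentiated as vector-valued functions, so every term expands into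
  iterated directional derivatives and these cancel.\<close>

lemma lie_bracket_jacobi:
  assumes "smooth X" "smooth Y" "smooth Z"
  shows "lie_bracket X (lie_bracket Y Z) p =
    lie_bracket (lie_bracket X Y) Z p + lie_bracket Y (lie_bracket X Z) p"
proof -
  have r: "dir_deriv U (lie_bracket V W) p = dir_deriv U (dir_deriv V W) p - dir_deriv U (dir_deriv W V) p"
    if "smooth V" "smooth W" for U V W
    unfolding lie_bracket_def using that by (intro dir_deriv_diff_right smooth_dir_deriv)
  show ?thesis
    unfolding lie_bracket_def[of _ "lie_bracket _ _"] lie_bracket_def[of "lie_bracket _ _"]
    using assms by (simp add: r dir_deriv_lie_bracket)
qed

section \<open>Killing fields are affine\<close>

lemma g2_commute: "g2 lam p v w = g2 lam p w v"
  by (simp add: g2_def mult.commute)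

lemma g2_linear_left: "linear (\<lambda>v. g2 lam p v w)"
  by (rule linearI) (simp_all add: g2_def algebra_simps)

lemma g2_linear_right: "linear (g2 lam p v)"
  by (rule linearI) (simp_all add: g2_def algebra_simps)

lemmas g2_bilinear =
  linear_add[OF g2_linear_left] linear_diff[OF g2_linear_left] linear_scale[OF g2_linear_left]
  linear_add[OF g2_linear_right] linear_diff[OF g2_linear_right] linear_scale[OF g2_linear_right]

lemma smooth_g2:
  assumes "smooth Y" "smooth Z"
  shows "smooth (\<lambda>p. g2 lam p (Y p) (Z p))"
  unfolding g2_def
  by (intro smooth_diff smooth_add smooth_mult smooth_const smooth_nth assms smooth_ident)

lemma g2_nondegenerate:
  assumes "lam \<noteq> 0" and 0: "\<And>w. g2 lam p v w = 0"
  shows "v = 0"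
  \<comment> \<open>The test vectors are orthogonal at \<open>p\<close>, with squares
    \<open>1 / lam\<^sup>2\<close>, 1 and -1.\<close>
  using 0[of "vector [1, 0, 0]"] 0[of "vector [0, 1, - p $ 1]"] 0[of "vector [0, 0, 1]"] \<open>lam \<noteq> 0\<close>
  by (simp add: g2_def vec_eq_iff forall_3 vector_3)

text \<open>The permutation argument behind the uniqueness of the Levi-Civita connection.\<close>

lemma g2_symmetric_skew_eq_0:
  assumes "lam \<noteq> 0"
    and sym: "\<And>Y Z. smooth Y \<Longrightarrow> smooth Z \<Longrightarrow> T Y Z p = T Z Y p"
    and skew: "\<And>Y Z W. smooth Y \<Longrightarrow> smooth Z \<Longrightarrow> smooth W \<Longrightarrow>
      g2 lam p (T Y Z p) (W p) + g2 lam p (Z p) (T Y W p) = 0"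
    and Y: "smooth Y" and Z: "smooth Z"
  shows "T Y Z p = 0"
proof (rule g2_nondegenerate[OF \<open>lam \<noteq> 0\<close>])
  fix w
  define W :: vfield where "W = (\<lambda>_. w)"
  have W: "smooth W" "W p = w" by (simp_all add: W_def smooth_const)
  \<comment> \<open>Each link applies skewness once, then symmetry. Three sign changes make the term
    its own negative.\<close>
  have "g2 lam p (T Y Z p) (W p) = - g2 lam p (T W Y p) (Z p)"
    using skew[OF Y Z W(1)] sym[OF Y W(1)] g2_commute[of lam p "Z p"] by auto
  also have "\<dots> = g2 lam p (T Z W p) (Y p)"
    using skew[OF W(1) Y Z] sym[OF W(1) Z] g2_commute[of lam p "Y p"] by auto
  also have "\<dots> = - g2 lam p (T Y Z p) (W p)"
    using skew[OF Z W(1) Y] sym[OF Z Y] g2_commute[of lam p "W p"] by auto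
  finally show "g2 lam p (T Y Z p) w = 0" using W(2) by simp
qed

lemma levi_civita_smooth:
  "levi_civita g nabla \<Longrightarrow> smooth Y \<Longrightarrow> smooth Z \<Longrightarrow> smooth (nabla Y Z)"
  unfolding levi_civita_def affine_connection_def by blast

lemma levi_civita_torsion_free:
  assumes "levi_civita g nabla" "smooth Y" "smooth Z"
  shows "nabla Y Z p - nabla Z Y p = lie_bracket Y Z p"
  by (rule fun_cong[where x = p]) (use assms in \<open>unfold levi_civita_def torsion_free_def, blast\<close>)

lemma levi_civita_metric_compatible:
  assumes "levi_civita g nabla" "smooth Y" "smooth Z" "smooth W"
  shows "dir_deriv Y (\<lambda>p. g p (Z p) (W p)) =
    (\<lambda>p. g p (nabla Y Z p) (W p) + g p (Z p) (nabla Y W p))"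
  using assms unfolding levi_civita_def metric_compatible_def by blast

text \<open>The difference of the two connections is symmetric because the torsion terms agree, and
  skew because both preserve the metric. This allows an arbitrary \<open>nabla\<close> to be
  replaced by the explicit \<open>nabla2\<close>.\<close>

lemma levi_civita_unique:
  assumes "lam \<noteq> 0" and n1: "levi_civita (g2 lam) nabla" and n2: "levi_civita (g2 lam) nabla'"
    and "smooth Y" "smooth Z"
  shows "nabla Y Z = nabla' Y Z"
proof
  fix p
  have "nabla Y Z p - nabla' Y Z p = 0"
  proof (rule g2_symmetric_skew_eq_0[OF \<open>lam \<noteq> 0\<close>, of "\<lambda>Y Z p. nabla Y Z p - nabla' Y Z p"])
    show "nabla Y Z p - nabla' Y Z p = nabla Z Y p - nabla' Z Y p"
      if "smooth Y" "smooth Z" for Y Z :: vfield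
      using levi_civita_torsion_free[OF n1 that] levi_civita_torsion_free[OF n2 that, symmetric]
      by (simp add: algebra_simps)
    show "g2 lam p (nabla Y Z p - nabla' Y Z p) (W p) + g2 lam p (Z p) (nabla Y W p - nabla' Y W p) = 0"
      if "smooth Y" "smooth Z" "smooth W" for Y Z W :: vfield
      using fun_cong[OF levi_civita_metric_compatible[OF n1 that], of p]
        fun_cong[OF levi_civita_metric_compatible[OF n2 that], of p]
      by (simp add: g2_bilinear)
  qed (use assms in auto)
  then show "nabla Y Z p = nabla' Y Z p" by simp
qed

lemma killing_imp_affine:
  assumes "lam \<noteq> 0" and lc: "levi_civita (g2 lam) nabla" and X: "smooth X"
    and kill: "killing_field (g2 lam) X"
  shows "affine_field nabla X"
  unfolding affine_field_def
proof (intro allI impI ext)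
  let ?L = "lie_bracket X"
  fix Y Z :: vfield and p
  assume YZ: "smooth Y \<and> smooth Z"
  note sn = levi_civita_smooth[OF lc] and tors = levi_civita_torsion_free[OF lc]
    and comp = levi_civita_metric_compatible[OF lc]
  have kill: "dir_deriv X (\<lambda>q. g2 lam q (Y q) (Z q)) =
      (\<lambda>p. g2 lam p (?L Y p) (Z p) + g2 lam p (Y p) (?L Z p))" if "smooth Y" "smooth Z" for Y Z :: vfield
    using kill that unfolding killing_field_def lie_deriv_metric_def
    by (auto simp: fun_eq_iff algebra_simps)
  \<comment> \<open>This is the Lie derivative of \<open>nabla\<close> along \<open>X\<close>. Its
    symmetry comes from vanishing torsion and the Jacobi identity.\<close>
  define T where "T Y Z p = ?L (nabla Y Z) p - nabla (?L Y) Z p - nabla Y (?L Z) p" for Y Z p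
  note smooths = X sn smooth_lie_bracket smooth_g2
  have "T Y Z p = 0"
  proof (rule g2_symmetric_skew_eq_0[OF \<open>lam \<noteq> 0\<close>, of T])
    show "T Y Z p = T Z Y p" if s: "smooth Y" "smooth Z" for Y Z :: vfield
    proof -
      have "?L (nabla Y Z) p - ?L (nabla Z Y) p = ?L (\<lambda>q. nabla Y Z q - nabla Z Y q) p"
        using s by (simp add: lie_bracket_def dir_deriv_diff_right smooths)
          (simp add: dir_deriv_def frechet_derivative_diff X)
      also have "\<dots> = ?L (lie_bracket Y Z) p" using tors[OF s] by presburger
      also have "\<dots> = lie_bracket (?L Y) Z p + lie_bracket Y (?L Z) p"
        by (rule lie_bracket_jacobi[OF X s])
      also have "\<dots> = (nabla (?L Y) Z p - nabla Z (?L Y) p) + (nabla Y (?L Z) p - nabla (?L Z) Y p)"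
        using s by (simp add: tors smooths)
      finally show ?thesis unfolding T_def by (simp add: algebra_simps)
    qed
    show "g2 lam p (T Y Z p) (W p) + g2 lam p (Z p) (T Y W p) = 0"
      if s: "smooth Y" "smooth Z" "smooth W" for Y Z W :: vfield
    proof -
      note s = s smooths
      \<comment> \<open>Expanding both sides by metric compatibility and the Killing equation leaves
        exactly the skewness of \<open>T\<close>.\<close>
      have "dir_deriv (?L Y) (\<lambda>p. g2 lam p (Z p) (W p)) p =
          dir_deriv X (dir_deriv Y (\<lambda>p. g2 lam p (Z p) (W p))) p
          - dir_deriv Y (dir_deriv X (\<lambda>p. g2 lam p (Z p) (W p))) p"
        by (intro dir_deriv_lie_bracket s)
      then show ?thesis
        unfolding T_def
        by (simp add: comp[of "?L Y"] comp[of Y] kill s dir_deriv_add_right g2_bilinear)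
    qed
  qed (use YZ in auto)
  then show "?L (nabla Y Z) p = nabla (?L Y) Z p + nabla Y (?L Z) p"
    unfolding T_def by (simp add: algebra_simps)
qed

section \<open>Affine fields preserve the curvature\<close>

text \<open>The curvature \<open>R(u, v) w\<close>. The first two coordinates and \<open>th\<close> are the components of a
  vector in the left-invariant frame \<open>E1, E2, E3\<close> defined below; \<open>c12, c13, c23\<close> are those of
  \<open>u \<and> v\<close>, and \<open>a, b, c\<close> those of the result.\<close>

definition riem2 :: "real \<Rightarrow> point \<Rightarrow> real^3 \<Rightarrow> real^3 \<Rightarrow> real^3 \<Rightarrow> real^3" where
  "riem2 lam p u v w = (
     let th = \<lambda>v. p $ 1 * v $ 2 + v $ 3;
         c12 = u $ 1 * v $ 2 - u $ 2 * v $ 1;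
         c13 = u $ 1 * th v - th u * v $ 1;
         c23 = u $ 2 * th v - th u * v $ 2;
         a = lam\<^sup>2 * (3 / 4 * c12 * w $ 2 + 1 / 4 * c13 * th w);
         b = - (3 / 4) * c12 * w $ 1 + lam\<^sup>2 / 4 * c23 * th w;
         c = 1 / 4 * c13 * w $ 1 + lam\<^sup>2 / 4 * c23 * w $ 2
     in vector [a, b, c - p $ 1 * b])"

lemma christoffel2_linear_left: "linear (\<lambda>v. christoffel2 lam p v w)"
  by (rule linearI) (simp_all add: christoffel2_def vec_eq_iff forall_3 vector_3 field_simps)

lemma christoffel2_linear_right: "linear (christoffel2 lam p v)"
  by (rule linearI) (simp_all add: christoffel2_def vec_eq_iff forall_3 vector_3 field_simps)

lemmas christoffel2_bilinear =
  linear_add[OF christoffel2_linear_left] linear_diff[OF christoffel2_linear_left]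
  linear_add[OF christoffel2_linear_right] linear_diff[OF christoffel2_linear_right]

text \<open>The derivative of the Christoffel symbols in the direction \<open>u\<close>, with \<open>v\<close> and \<open>w\<close> fixed.\<close>

definition dchristoffel2 :: "real \<Rightarrow> point \<Rightarrow> real^3 \<Rightarrow> real^3 \<Rightarrow> real^3 \<Rightarrow> real^3" where
  "dchristoffel2 lam p u v w = u $ 1 *\<^sub>R vector [
     lam\<^sup>2 * (v $ 2 * w $ 2),
     - (1 / 2) * (v $ 1 * w $ 2 + v $ 2 * w $ 1),
     p $ 1 * (v $ 1 * w $ 2 + v $ 2 * w $ 1) + 1 / 2 * (v $ 1 * w $ 3 + v $ 3 * w $ 1)]"

lemma dir_deriv_nth: "smooth f \<Longrightarrow> dir_deriv X f p $ i = dir_deriv X (\<lambda>q. f q $ i) p"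
  unfolding dir_deriv_def
  by (simp add: frechet_derivative_bounded_linear[OF bounded_linear_vec_nth])

lemma dir_deriv_mult:
  fixes f g :: "point \<Rightarrow> real"
  assumes "smooth f" "smooth g"
  shows "dir_deriv X (\<lambda>q. f q * g q) p = f p * dir_deriv X g p + dir_deriv X f p * g p"
  using dir_deriv_eqI[OF has_derivative_mult[OF assms[THEN dir_deriv_has_derivative]]]
  by (simp add: dir_deriv_def)

lemma dir_deriv_const: "dir_deriv X (\<lambda>q. c) p = 0"
  by (simp add: dir_deriv_def)

lemma dir_deriv_minus_right:
  "smooth f \<Longrightarrow> dir_deriv X (\<lambda>q. - f q) p = - dir_deriv X f p"
  using dir_deriv_diff_right[OF smooth_const, of f X 0] by (simp add: dir_deriv_const)

lemma dir_deriv_ident_nth: "dir_deriv X (\<lambda>q. q $ i) p = X p $ i"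
  using dir_deriv_eqI[OF bounded_linear_imp_has_derivative[OF bounded_linear_vec_nth]] .

lemma dir_deriv_christoffel2:
  assumes V: "smooth V" and W: "smooth W"
  shows "dir_deriv U (\<lambda>q. christoffel2 lam q (V q) (W q)) p = dchristoffel2 lam p (U p) (V p) (W p)
    + christoffel2 lam p (dir_deriv U V p) (W p) + christoffel2 lam p (V p) (dir_deriv U W p)"
proof -
  note s = smooth_diff smooth_add smooth_mult smooth_const smooth_nth[OF V] smooth_nth[OF W]
    smooth_nth[OF smooth_ident] smooth_minus
  \<comment> \<open>Naming \<open>lam\<^sup>2 / 2\<close> and \<open>1 / 2\<close> keeps the simplifier from creating divisions, for which
    there are no \<open>dir_deriv\<close> rules.\<close>
  obtain k where k: "lam\<^sup>2 = 2 * k" by (rule that[of "lam\<^sup>2 / 2"]) simp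
  obtain h :: real where h: "h = 1 / 2" by blast
  have c: "christoffel2 lam q v w = vector [
     2 * k * (q $ 1 * (v $ 2 * w $ 2)) + k * (v $ 2 * w $ 3 + v $ 3 * w $ 2),
     - h * (q $ 1 * (v $ 1 * w $ 2 + v $ 2 * w $ 1)) + - h * (v $ 1 * w $ 3 + v $ 3 * w $ 1),
     h * ((q $ 1 * q $ 1 + 1) * (v $ 1 * w $ 2 + v $ 2 * w $ 1)
       + q $ 1 * (v $ 1 * w $ 3 + v $ 3 * w $ 1))]" for q v w
    by (simp add: christoffel2_def k vec_eq_iff forall_3 vector_3; simp add: h field_simps power2_eq_square)
  show ?thesis
    unfolding vec_eq_iff
    by (simp add: dir_deriv_nth smooth_christoffel2 V W)
      (simp add: c k dchristoffel2_def forall_3 dir_deriv_mult dir_deriv_add_right dir_deriv_const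
        dir_deriv_diff_right dir_deriv_minus_right dir_deriv_ident_nth dir_deriv_nth V W s algebra_simps; simp add: h)
qed

text \<open>The left side is the coordinate formula for the curvature; \<open>riem2\<close> is its
  form in left-invariant components.\<close>

lemma riem2_christoffel2:
  "dchristoffel2 lam p u v w - dchristoffel2 lam p v u w
    + christoffel2 lam p u (christoffel2 lam p v w) - christoffel2 lam p v (christoffel2 lam p u w)
    = riem2 lam p u v w" (is "?L = ?R")
proof -
  obtain x u1 u2 u3 v1 v2 v3 w1 w2 w3 where *: "x = p $ 1" "u1 = u $ 1" "u2 = u $ 2" "u3 = u $ 3"
    "v1 = v $ 1" "v2 = v $ 2" "v3 = v $ 3" "w1 = w $ 1" "w2 = w $ 2" "w3 = w $ 3" by blast
  have "?L $ 1 = ?R $ 1"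
    by (simp add: dchristoffel2_def christoffel2_def riem2_def Let_def vector_3 *[symmetric])
      (simp add: power2_eq_square field_simps)
  moreover have "?L $ 2 = ?R $ 2"
    by (simp add: dchristoffel2_def christoffel2_def riem2_def Let_def vector_3 *[symmetric])
      (simp add: power2_eq_square field_simps)
  moreover have "?L $ 3 = ?R $ 3"
    by (simp add: dchristoffel2_def christoffel2_def riem2_def Let_def vector_3 *[symmetric])
      (simp add: power2_eq_square field_simps)
  ultimately show ?thesis by (simp only: vec_eq_iff forall_3)
qed

text \<open>The second derivatives of \<open>W\<close> and the first derivatives of all three fields
  cancel, leaving the Christoffel terms at \<open>p\<close>.\<close>

lemma curvature_nabla2:
  assumes U: "smooth U" and V: "smooth V" and W: "smooth W"
  shows "nabla2 lam U (nabla2 lam V W) p - nabla2 lam V (nabla2 lam U W) p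
    - nabla2 lam (lie_bracket U V) W p = riem2 lam p (U p) (V p) (W p)"
proof -
  have D: "dir_deriv U (nabla2 lam V W) p = dir_deriv U (dir_deriv V W) p
      + dchristoffel2 lam p (U p) (V p) (W p)
      + christoffel2 lam p (dir_deriv U V p) (W p) + christoffel2 lam p (V p) (dir_deriv U W p)"
    if V: "smooth V" for U V
    unfolding nabla2_def
    by (simp add: dir_deriv_add_right smooth_dir_deriv smooth_christoffel2 V W dir_deriv_christoffel2)
  have N: "nabla2 lam U (nabla2 lam V W) p = dir_deriv U (nabla2 lam V W) p
      + christoffel2 lam p (U p) (dir_deriv V W p)
      + christoffel2 lam p (U p) (christoffel2 lam p (V p) (W p))" for U V
    by (simp add: nabla2_def[of lam U] nabla2_def[of lam V W] christoffel2_bilinear)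
  have B: "nabla2 lam (lie_bracket U V) W p = dir_deriv U (dir_deriv V W) p - dir_deriv V (dir_deriv U W) p
      + christoffel2 lam p (dir_deriv U V p) (W p) - christoffel2 lam p (dir_deriv V U p) (W p)"
    by (simp add: nabla2_def dir_deriv_lie_bracket U V W)
      (simp add: lie_bracket_def christoffel2_bilinear)
  show ?thesis
    unfolding N D[OF V] D[OF U] B riem2_christoffel2[symmetric] by (simp add: algebra_simps)
qed

lemma smooth_nabla2: "smooth Y \<Longrightarrow> smooth Z \<Longrightarrow> smooth (nabla2 lam Y Z)"
  unfolding nabla2_def by (intro smooth_add smooth_dir_deriv smooth_christoffel2)

lemma lie_bracket_diff_right:
  assumes "smooth X" "smooth Y" "smooth Z"
  shows "lie_bracket X (\<lambda>q. Y q - Z q) p = lie_bracket X Y p - lie_bracket X Z p"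
  using assms by (simp add: lie_bracket_def dir_deriv_diff_right)
    (simp add: dir_deriv_def frechet_derivative_diff)

text \<open>Bracketing with \<open>X\<close> obeys the Leibniz rule for \<open>nabla2\<close>, by
  affinity, and for the bracket, by the Jacobi identity; hence also for the curvature built from
  them.\<close>

lemma affine_field_riem2:
  assumes aff: "affine_field (nabla2 lam) X"
    and X: "smooth X" and U: "smooth U" and V: "smooth V" and W: "smooth W"
  shows "lie_bracket X (\<lambda>p. riem2 lam p (U p) (V p) (W p)) p =
    riem2 lam p (lie_bracket X U p) (V p) (W p) + riem2 lam p (U p) (lie_bracket X V p) (W p)
    + riem2 lam p (U p) (V p) (lie_bracket X W p)"
proof -
  let ?L = "lie_bracket X" and ?N = "nabla2 lam"
  note s = X U V W smooth_lie_bracket smooth_nabla2 smooth_diff smooth_add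
  have aff: "?L (?N Y Z) = (\<lambda>p. ?N (?L Y) Z p + ?N Y (?L Z) p)" if "smooth Y" "smooth Z" for Y Z
    using aff that unfolding affine_field_def by blast
  have right: "?N Y (\<lambda>p. Z p + Z' p) p = ?N Y Z p + ?N Y Z' p" if "smooth Z" "smooth Z'" for Y Z Z'
    using that by (simp add: nabla2_def dir_deriv_add_right christoffel2_bilinear)
  have left: "?N (\<lambda>p. Y p + Y' p) W p = ?N Y W p + ?N Y' W p" for Y Y'
    using linear_add[OF linear_frechet_derivative[OF smooth_differentiable[OF W]]]
    by (simp add: nabla2_def dir_deriv_def christoffel2_bilinear)
  have two: "?L (?N Y (?N Z W)) p = ?N (?L Y) (?N Z W) p + ?N Y (?N (?L Z) W) p + ?N Y (?N Z (?L W)) p"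
    if "smooth Y" "smooth Z" for Y Z
    using that by (simp add: aff s right)
  have "?L (?N (lie_bracket U V) W) p = ?N (?L (lie_bracket U V)) W p + ?N (lie_bracket U V) (?L W) p"
    by (simp add: aff s)
  also have "?L (lie_bracket U V) = (\<lambda>p. lie_bracket (?L U) V p + lie_bracket U (?L V) p)"
    using lie_bracket_jacobi[OF X U V] by blast
  finally have bracket: "?L (?N (lie_bracket U V) W) p =
      ?N (lie_bracket (?L U) V) W p + ?N (lie_bracket U (?L V)) W p + ?N (lie_bracket U V) (?L W) p"
    by (simp add: left)
  have "?L (\<lambda>p. riem2 lam p (U p) (V p) (W p)) p =
      ?L (?N U (?N V W)) p - ?L (?N V (?N U W)) p - ?L (?N (lie_bracket U V) W) p"
    by (simp add: curvature_nabla2[symmetric] lie_bracket_diff_right s)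
  also have "\<dots> = riem2 lam p (?L U p) (V p) (W p) + riem2 lam p (U p) (?L V p) (W p)
      + riem2 lam p (U p) (V p) (?L W p)"
    unfolding two[OF U V] two[OF V U] bracket
    by (simp add: curvature_nabla2[symmetric] s)
  finally show ?thesis .
qed

section \<open>From invariant curvature to the Killing equation\<close>

lemma lie_bracket_scaleR_right:
  assumes "smooth X" "smooth Y"
  shows "lie_bracket X (\<lambda>q. c *\<^sub>R Y q) p = c *\<^sub>R lie_bracket X Y p"
proof -
  have "dir_deriv X (\<lambda>q. c *\<^sub>R Y q) p = c *\<^sub>R dir_deriv X Y p"
    using frechet_derivative_bounded_linear[OF bounded_linear_scaleR_right assms(2)]
    by (simp add: dir_deriv_def)
  moreover have "dir_deriv (\<lambda>q. c *\<^sub>R Y q) X p = c *\<^sub>R dir_deriv Y X p"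
    unfolding dir_deriv_def
    by (rule linear_scale[OF linear_frechet_derivative[OF smooth_differentiable[OF assms(1)]]])
  ultimately show ?thesis by (simp add: lie_bracket_def algebra_simps)
qed

text \<open>Left-invariant frame, orthogonal for \<open>g2 lam\<close>.\<close>

definition E1 :: vfield where "E1 p = vector [1, 0, 0]"
definition E2 :: vfield where "E2 p = vector [0, 1, - p $ 1]"
definition E3 :: vfield where "E3 p = vector [0, 0, 1]"

lemma smooth_frame: "smooth E1" "smooth E2" "smooth E3"
  unfolding E1_def[abs_def] E2_def[abs_def] E3_def[abs_def]
  by (intro smooth_vector3 smooth_const smooth_minus smooth_nth smooth_ident)+

lemma frame_expand: "v = v $ 1 *\<^sub>R E1 p + v $ 2 *\<^sub>R E2 p + (p $ 1 * v $ 2 + v $ 3) *\<^sub>R E3 p"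
  by (simp add: vec_eq_iff forall_3 vector_3 E1_def E2_def E3_def)

text \<open>The brackets \<open>[X, E\<^sub>i]\<close> are the columns of an endomorphism annihilating the curvature tensor; the
  five constant curvature components used here already force it to be skew for the metric.\<close>

lemma affine_field_bracket_frame:
  assumes "lam \<noteq> 0" and aff: "affine_field (nabla2 lam) X" and X: "smooth X"
  shows "lie_bracket X E1 p $ 1 = 0" "lie_bracket X E1 p $ 3 = - p $ 1 * lie_bracket X E1 p $ 2"
    "lie_bracket X E2 p $ 1 = - lam\<^sup>2 * lie_bracket X E1 p $ 2"
    "lie_bracket X E2 p $ 2 = 0" "lie_bracket X E2 p $ 3 = 0" "lie_bracket X E3 p = 0"
proof -
  let ?w1 = "lie_bracket X E1 p" and ?w2 = "lie_bracket X E2 p" and ?w3 = "lie_bracket X E3 p"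
  have 121: "(\<lambda>p. riem2 lam p (E1 p) (E2 p) (E1 p)) = (\<lambda>p. (- 3 / 4) *\<^sub>R E2 p)"
    and 122: "(\<lambda>p. riem2 lam p (E1 p) (E2 p) (E2 p)) = (\<lambda>p. (3 / 4 * lam\<^sup>2) *\<^sub>R E1 p)"
    and 131: "(\<lambda>p. riem2 lam p (E1 p) (E3 p) (E1 p)) = (\<lambda>p. (1 / 4) *\<^sub>R E3 p)"
    and 133: "(\<lambda>p. riem2 lam p (E1 p) (E3 p) (E3 p)) = (\<lambda>p. (lam\<^sup>2 / 4) *\<^sub>R E1 p)"
    and 232: "(\<lambda>p. riem2 lam p (E2 p) (E3 p) (E2 p)) = (\<lambda>p. (lam\<^sup>2 / 4) *\<^sub>R E3 p)"
    by (simp_all add: fun_eq_iff vec_eq_iff forall_3 vector_3 riem2_def E1_def E2_def E3_def)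
  note R = affine_field_riem2[OF aff X, of _ _ _ p]
  note eval = riem2_def Let_def vector_3 E1_def[of p] E2_def[of p] E3_def[of p]
  note r121 = R[OF smooth_frame(1,2,1), unfolded 121 lie_bracket_scaleR_right[OF X smooth_frame(2)]]
  note r122 = R[OF smooth_frame(1,2,2), unfolded 122 lie_bracket_scaleR_right[OF X smooth_frame(1)]]
  note r131 = R[OF smooth_frame(1,3,1), unfolded 131 lie_bracket_scaleR_right[OF X smooth_frame(3)]]
  note r133 = R[OF smooth_frame(1,3,3), unfolded 133 lie_bracket_scaleR_right[OF X smooth_frame(1)]]
  note r232 = R[OF smooth_frame(2,3,2), unfolded 232 lie_bracket_scaleR_right[OF X smooth_frame(3)]]
  \<comment> \<open>\<open>?w2 $ 2\<close> occurs once on each side and cancels, while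
    \<open>?w1 $ 1\<close> occurs twice on the right only. This rules out scaling.\<close>
  show w11: "?w1 $ 1 = 0" using arg_cong[OF r121, of "\<lambda>v. v $ 2"] by (simp add: eval)
  show w22: "?w2 $ 2 = 0" using arg_cong[OF r122, of "\<lambda>v. v $ 1"] w11 \<open>lam \<noteq> 0\<close> by (simp add: eval)
  show w21: "?w2 $ 1 = - lam\<^sup>2 * ?w1 $ 2" using arg_cong[OF r122, of "\<lambda>v. v $ 2"] by (simp add: eval)
  \<comment> \<open>The bracketed sum is the \<open>E3\<close> component of
    \<open>?w1\<close>.\<close>
  have "lam\<^sup>2 * (?w1 $ 3 + p $ 1 * ?w1 $ 2) = 0"
    using arg_cong[OF r122, of "\<lambda>v. v $ 3"] w21 w22 by (simp add: eval algebra_simps)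
  then show "?w1 $ 3 = - p $ 1 * ?w1 $ 2" using \<open>lam \<noteq> 0\<close> by (simp add: add_eq_0_iff)
  show "?w2 $ 3 = 0" using arg_cong[OF r121, of "\<lambda>v. v $ 3"] w11 w22 by (simp add: eval algebra_simps)
  \<comment> \<open>The unknown has coefficient \<open>lam\<^sup>2 / 4\<close> on the left but
    \<open>- 3 / 4 * lam\<^sup>2\<close> on the right: the curvature constants of the planes
    differ.\<close>
  have "?w3 $ 1 = 0" using arg_cong[OF r232, of "\<lambda>v. v $ 1"] \<open>lam \<noteq> 0\<close> by (simp add: eval)
  moreover have w32: "?w3 $ 2 = 0" using arg_cong[OF r131, of "\<lambda>v. v $ 2"] by (simp add: eval)
  moreover have "?w3 $ 3 = 0" using arg_cong[OF r133, of "\<lambda>v. v $ 1"] w11 w32 \<open>lam \<noteq> 0\<close> by (simp add: eval)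
  ultimately show "?w3 = 0" by (simp add: vec_eq_iff forall_3)
qed

text \<open>The endomorphism is the covariant derivative of \<open>X\<close>: by vanishing torsion
  its value at \<open>Y p\<close> is \<open>nabla2 lam X Y p - lie_bracket X Y p\<close>, and metric
  compatibility does the rest.\<close>

lemma lie_deriv_g2_tensorial:
  assumes "lam \<noteq> 0" and X: "smooth X"
  obtains M where "linear M" "\<And>Y Z. smooth Y \<Longrightarrow> smooth Z \<Longrightarrow>
    lie_deriv_metric X (g2 lam) Y Z p = g2 lam p (M (Y p)) (Z p) + g2 lam p (Y p) (M (Z p))"
proof
  let ?M = "\<lambda>v. frechet_derivative X (at p) v + christoffel2 lam p v (X p)"
  show "linear ?M"
    by (intro linear_compose_add christoffel2_linear_left linear_frechet_derivative
        smooth_differentiable X)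
  fix Y Z :: vfield assume Y: "smooth Y" and Z: "smooth Z"
  have lc: "levi_civita (g2 lam) (nabla2 lam)" by (rule levi_civita_nabla2[OF \<open>lam \<noteq> 0\<close>])
  have M: "?M (Y p) = nabla2 lam X Y p - lie_bracket X Y p" if "smooth Y" for Y :: vfield
  proof -
    have "nabla2 lam X Y p - nabla2 lam Y X p = lie_bracket X Y p"
      by (rule levi_civita_torsion_free[OF lc X that])
    then show ?thesis by (simp add: nabla2_def[of lam Y] dir_deriv_def algebra_simps)
  qed
  have "dir_deriv X (\<lambda>p. g2 lam p (Y p) (Z p)) p =
      g2 lam p (nabla2 lam X Y p) (Z p) + g2 lam p (Y p) (nabla2 lam X Z p)"
    by (rule fun_cong[OF levi_civita_metric_compatible[OF lc X Y Z]])
  then show "lie_deriv_metric X (g2 lam) Y Z p = g2 lam p (?M (Y p)) (Z p) + g2 lam p (Y p) (?M (Z p))"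
    by (simp add: lie_deriv_metric_def M[OF Y] M[OF Z] g2_bilinear)
qed

text \<open>At each point the Lie derivative of the metric is a bilinear form in the values of the
  fields, so it is determined by the frame.\<close>

lemma killing_field_g2_frameI:
  assumes "lam \<noteq> 0" and X: "smooth X"
    and frame: "\<And>Y Z p. Y \<in> {E1, E2, E3} \<Longrightarrow> Z \<in> {E1, E2, E3} \<Longrightarrow> lie_deriv_metric X (g2 lam) Y Z p = 0"
  shows "killing_field (g2 lam) X"
  unfolding killing_field_def
proof (intro allI impI ext)
  fix Y Z :: vfield and p
  assume YZ: "smooth Y \<and> smooth Z"
  obtain M where M: "linear M" "\<And>Y Z. smooth Y \<Longrightarrow> smooth Z \<Longrightarrow>
    lie_deriv_metric X (g2 lam) Y Z p = g2 lam p (M (Y p)) (Z p) + g2 lam p (Y p) (M (Z p))"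
    using lie_deriv_g2_tensorial[OF assms(1,2)] by blast
  define S where "S v w = g2 lam p (M v) w + g2 lam p v (M w)" for v w
  have add: "S (v + v') w = S v w + S v' w" "S w (v + v') = S w v + S w v'"
    and scale: "S (c *\<^sub>R v) w = c * S v w" "S w (c *\<^sub>R v) = c * S w v" for v v' w c
    by (simp_all add: S_def g2_bilinear linear_add[OF M(1)] linear_scale[OF M(1)] algebra_simps)
  have 0: "S (A p) (B p) = 0" if "A \<in> {E1, E2, E3}" "B \<in> {E1, E2, E3}" for A B
    using frame[OF that] M(2)[of A B] that smooth_frame by (auto simp: S_def)
  have "S v w = 0" for v w
    by (subst frame_expand[of v p], subst frame_expand[of w p]) (simp add: add scale 0)
  then show "lie_deriv_metric X (g2 lam) Y Z p = 0"
    using YZ M(2) by (simp add: S_def)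
qed

lemma affine_nabla2_imp_killing:
  assumes "lam \<noteq> 0" and aff: "affine_field (nabla2 lam) X" and X: "smooth X"
  shows "killing_field (g2 lam) X"
proof (rule killing_field_g2_frameI[OF \<open>lam \<noteq> 0\<close> X])
  fix Y Z p
  assume YZ: "Y \<in> {E1, E2, E3}" "Z \<in> {E1, E2, E3}"
  \<comment> \<open>Products of left-invariant fields are constant, so only the bracket terms of the
    Lie derivative remain.\<close>
  have "(\<lambda>q. g2 lam q (Y q) (Z q)) = (\<lambda>q. g2 lam p (Y p) (Z p))"
    using YZ by (auto simp: g2_def E1_def E2_def E3_def vector_3)
  then have "dir_deriv X (\<lambda>q. g2 lam q (Y q) (Z q)) p = 0"
    using dir_deriv_const[of X "g2 lam p (Y p) (Z p)" p] by simp
  moreover have "g2 lam p (lie_bracket X Y p) (Z p) + g2 lam p (Y p) (lie_bracket X Z p) = 0"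
    \<comment> \<open>With \<open>b\<close> the \<open>E2\<close> component of
      \<open>[X, E1]\<close>, the brackets send \<open>E1\<close> to \<open>b E2\<close>,
      \<open>E2\<close> to \<open>- lam\<^sup>2 b E1\<close> and \<open>E3\<close> to 0. The two
      terms for \<open>E1, E2\<close> cancel as \<open>E1\<close> has square
      \<open>1 / lam\<^sup>2\<close>.\<close>
    using YZ affine_field_bracket_frame[OF assms, of p] \<open>lam \<noteq> 0\<close>
    by (auto simp: g2_def E1_def[of p] E2_def[of p] E3_def[of p] vector_3 field_simps)
  ultimately show "lie_deriv_metric X (g2 lam) Y Z p = 0"
    by (simp add: lie_deriv_metric_def)
qed

theorem theorem3p8:
  fixes lam :: real and nabla :: connection and X :: vfield
  assumes "lam \<noteq> 0"
    and "levi_civita (g2 lam) nabla"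
    and "smooth X"
  shows "affine_field nabla X \<longleftrightarrow> killing_field (g2 lam) X"
proof
  assume aff: "affine_field nabla X"
  \<comment> \<open>The connections agree on smooth fields, which suffices since brackets of smooth
    fields are smooth.\<close>
  have eq: "nabla Y Z = nabla2 lam Y Z" if "smooth Y" "smooth Z" for Y Z
    by (rule levi_civita_unique[OF assms(1,2) levi_civita_nabla2[OF assms(1)] that])
  have "affine_field (nabla2 lam) X"
    using aff \<open>smooth X\<close> unfolding affine_field_def by (simp add: eq smooth_lie_bracket)
  then show "killing_field (g2 lam) X"
    using affine_nabla2_imp_killing assms by blast
qed (use killing_imp_affine assms in blast)

end
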